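(* Let $G$ be a Lie group with (finite-dimensional real) Lie algebra $\mathfrak{g}$, endowed with a left-invariant complex structure $J$, and suppose that: 1) $\mathfrak{g}$ is a semidirect product $\mathfrak{g}=\mathfrak{s}\ltimes_{\phi}\mathfrak{h}$, where $\mathfrak{s}$ is a solvable Lie algebra and $\mathfrak{h}$ is a Lie algebra; 2) $\phi:\mathfrak{s}\to \mathrm{Der}(\mathfrak{h})$ is a representation on the space of derivations of $\mathfrak{h}$; 3) $\phi$ is not of type (I) and the image $\phi(\mathfrak{s})$ is a nilpotent subalgebra of $\mathrm{Der}(\mathfrak{h})$; 4) $J(\mathfrak{h})\subset\mathfrak{h}$; 5) $J_{|\mathfrak{h}}\circ\phi(X)=\phi(X)\circ J_{|\mathfrak{h}}$ for every $X\in\mathfrak{s}$. Then $\mathfrak{g}$ does not admit any symplectic structure taming $J$. Moreover, if $\mathfrak{s}$ is nilpotent and $J(\mathfrak{s})\subset\mathfrak{s}$, then $\mathfrak{g}$ does not admit any $J$-Hermitian SKT metric.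
   Context: A left-invariant complex structure on $G$ is identified with an integrable endomorphism $J$ of $\mathfrak{g}$ with $J^2=-\mathrm{Id}$. Left-invariant forms on $G$ are identified with elements of $\bigwedge\mathfrak{g}^*$, with the induced (Chevalley–Eilenberg) differential $d$. In $\mathfrak{g}=\mathfrak{s}\ltimes_\phi\mathfrak{h}$, $\mathfrak{h}$ is an ideal, $\mathfrak{s}$ is a subalgebra, and $[X,Y]=\phi(X)Y$ for $X\in\mathfrak{s}$, $Y\in\mathfrak{h}$. A representation $\rho$ of a Lie algebra $\mathfrak{s}$ on a real vector space is of type (I) if for every $X\in\mathfrak{s}$ all the (complex) eigenvalues of $\rho(X)$ are purely imaginary (zero included). A symplectic structure on $\mathfrak{g}$ taming $J$ is a non-degenerate closed $2$-form $\Omega\in\bigwedge^2\mathfrak{g}^*$ such that $\Omega(X,JX)>0$ for every nonzero $X\in\mathfrak{g}$. A $J$-Hermitian SKT (strong Kähler with torsion) metric on $\mathfrak{g}$ is a positive-definite inner product on $\mathfrak{g}$ compatible with $J$ (i.e. $J$ is orthogonal) whose fundamental $2$-form $\omega$ satisfies $\partial\bar\partial\omega=0$ (equivalently $dd^c\omega=0$, where $d^c=J^{-1}dJ$). *)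

theory Defs
  imports "HOL-Analysis.Analysis"
begin

section \<open>Lie algebras\<close>

definition lie_bracket :: "('a::real_vector \<Rightarrow> 'a \<Rightarrow> 'a) \<Rightarrow> bool" where
  "lie_bracket br \<longleftrightarrow> bilinear br \<and> (\<forall>x. br x x = 0) \<and>
     (\<forall>x y z. br x (br y z) + br y (br z x) + br z (br x y) = 0)"

primrec derived_series :: "('a::real_vector \<Rightarrow> 'a \<Rightarrow> 'a) \<Rightarrow> 'a set \<Rightarrow> nat \<Rightarrow> 'a set" where
  "derived_series br L 0 = L"
| "derived_series br L (Suc n) =
     span {br x y | x y. x \<in> derived_series br L n \<and> y \<in> derived_series br L n}"

definition solvable :: "('a::real_vector \<Rightarrow> 'a \<Rightarrow> 'a) \<Rightarrow> 'a set \<Rightarrow> bool" where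
  "solvable br L \<longleftrightarrow> (\<exists>n. derived_series br L n = {0})"

primrec lower_central_series :: "('a::real_vector \<Rightarrow> 'a \<Rightarrow> 'a) \<Rightarrow> 'a set \<Rightarrow> nat \<Rightarrow> 'a set" where
  "lower_central_series br L 0 = L"
| "lower_central_series br L (Suc n) =
     span {br x y | x y. x \<in> L \<and> y \<in> lower_central_series br L n}"

definition nilpotent :: "('a::real_vector \<Rightarrow> 'a \<Rightarrow> 'a) \<Rightarrow> 'a set \<Rightarrow> bool" where
  "nilpotent br L \<longleftrightarrow> (\<exists>n. lower_central_series br L n = {0})"

definition lie_subalgebra :: "('a::real_vector \<Rightarrow> 'a \<Rightarrow> 'a) \<Rightarrow> 'a set \<Rightarrow> bool" where
  "lie_subalgebra br L \<longleftrightarrow> subspace L \<and> (\<forall>x\<in>L. \<forall>y\<in>L. br x y \<in> L)"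

text \<open>In finite dimension every endomorphism is bounded, so \<^typ>\<open>'h::euclidean_space \<Rightarrow>\<^sub>L 'h\<close>
  is the full algebra of endomorphisms.\<close>

definition commutator ::
    "('h::real_normed_vector \<Rightarrow>\<^sub>L 'h) \<Rightarrow> ('h \<Rightarrow>\<^sub>L 'h) \<Rightarrow> ('h \<Rightarrow>\<^sub>L 'h)" where
  "commutator A B = (A o\<^sub>L B) - (B o\<^sub>L A)"

definition Der :: "('h::real_normed_vector \<Rightarrow> 'h \<Rightarrow> 'h) \<Rightarrow> ('h \<Rightarrow>\<^sub>L 'h) set" where
  "Der br = {D. \<forall>y z. blinfun_apply D (br y z) = br (D y) z + br y (D z)}"

definition lie_representation ::
    "('s::real_vector \<Rightarrow> 's \<Rightarrow> 's) \<Rightarrow> ('s \<Rightarrow> ('h::real_normed_vector \<Rightarrow>\<^sub>L 'h)) \<Rightarrow> bool" where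
  "lie_representation br \<rho> \<longleftrightarrow> linear \<rho> \<and> (\<forall>x y. \<rho> (br x y) = commutator (\<rho> x) (\<rho> y))"

text \<open>The semidirect product lives on \<open>'s \<times> 'h\<close>, with \<open>\<ss>\<close> identified with \<open>UNIV \<times> {0}\<close> and
  \<open>\<hh>\<close> with \<open>{0} \<times> UNIV\<close>.\<close>

definition semidirect_bracket ::
    "('s::real_vector \<Rightarrow> 's \<Rightarrow> 's) \<Rightarrow> ('h::real_normed_vector \<Rightarrow> 'h \<Rightarrow> 'h) \<Rightarrow> ('s \<Rightarrow> ('h \<Rightarrow>\<^sub>L 'h)) \<Rightarrow>
     's \<times> 'h \<Rightarrow> 's \<times> 'h \<Rightarrow> 's \<times> 'h" where
  "semidirect_bracket brs brh \<phi> = (\<lambda>(X, Y) (X', Y').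
     (brs X X', brh Y Y' + \<phi> X Y' - \<phi> X' Y))"

definition restrict_h :: "('s::real_vector \<times> 'h::real_vector \<Rightarrow> 's \<times> 'h) \<Rightarrow> 'h \<Rightarrow> 'h" where
  "restrict_h J Y = snd (J (0, Y))"

lemma lie_bracket_semidirect:
  assumes "lie_bracket brs" "lie_bracket brh" "lie_representation brs \<phi>" "range \<phi> \<subseteq> Der brh"
  shows "lie_bracket (semidirect_bracket brs brh \<phi>)"
proof -
  have bs: "bilinear brs" and bh: "bilinear brh" and l\<phi>: "linear \<phi>"
    and \<phi>br: "\<And>x y. \<phi> (brs x y) = commutator (\<phi> x) (\<phi> y)"
    and der: "\<And>X y z. \<phi> X (brh y z) = brh (\<phi> X y) z + brh y (\<phi> X z)"
    using assms by (auto simp: lie_bracket_def lie_representation_def Der_def image_subset_iff)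
  have altS: "brs x x = 0" and altH: "brh y y = 0" for x y
    using assms by (auto simp: lie_bracket_def)
  have jacS: "brs x (brs y z) + brs y (brs z x) + brs z (brs x y) = 0"
    and jacH: "brh u (brh v w) + brh v (brh w u) + brh w (brh u v) = 0" for x y z u v w
    using assms by (auto simp: lie_bracket_def)
  have antiH: "brh y z = - brh z y" for y z
    using altH[of "y + z"] altH[of y] altH[of z]
    by (simp add: bilinear_ladd[OF bh] bilinear_radd[OF bh] eq_neg_iff_add_eq_0 add.commute)
  note [simp] = blinfun.add_left blinfun.add_right blinfun.diff_left blinfun.diff_right
    blinfun.scaleR_left blinfun.scaleR_right linear_add[OF l\<phi>] linear_cmul[OF l\<phi>]
    bilinear_ladd[OF bs] bilinear_radd[OF bs] bilinear_lmul[OF bs] bilinear_rmul[OF bs]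
    bilinear_ladd[OF bh] bilinear_radd[OF bh] bilinear_lmul[OF bh] bilinear_rmul[OF bh]
    bilinear_lsub[OF bh] bilinear_rsub[OF bh]
  have "bilinear (semidirect_bracket brs brh \<phi>)"
    unfolding bilinear_def semidirect_bracket_def
    by (auto intro!: linearI simp: algebra_simps)
  moreover have "semidirect_bracket brs brh \<phi> x x = 0" for x
    by (cases x) (simp add: semidirect_bracket_def altS altH zero_prod_def)
  moreover have "semidirect_bracket brs brh \<phi> x (semidirect_bracket brs brh \<phi> y z)
      + semidirect_bracket brs brh \<phi> y (semidirect_bracket brs brh \<phi> z x)
      + semidirect_bracket brs brh \<phi> z (semidirect_bracket brs brh \<phi> x y) = 0" for x y z
  proof -
    obtain a u b v c w where xyz: "x = (a, u)" "y = (b, v)" "z = (c, w)"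
      by (metis surj_pair)
    show ?thesis
      using jacS[of a b c] jacH[of u v w] antiH[of u "\<phi> b w"] antiH[of v "\<phi> a w"]
        antiH[of v "\<phi> c u"] antiH[of u "\<phi> c v"] antiH[of w "\<phi> a v"] antiH[of w "\<phi> b u"]
      by (simp add: xyz semidirect_bracket_def \<phi>br der commutator_def zero_prod_def
          algebra_simps)
  qed
  ultimately show ?thesis by (simp add: lie_bracket_def)
qed

lemma lie_subalgebra_range_representation:
  assumes "lie_representation br \<rho>"
  shows "lie_subalgebra commutator (range \<rho>)"
proof -
  have l: "linear \<rho>" and c: "\<And>x y. commutator (\<rho> x) (\<rho> y) = \<rho> (br x y)"
    using assms by (auto simp: lie_representation_def)
  show ?thesis
    using linear_subspace_image[OF l subspace_UNIV]
    by (auto simp: lie_subalgebra_def c)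
qed

section \<open>Complexification\<close>

text \<open>The complexification of a real vector space \<open>V\<close> is \<open>V \<times> V\<close>, where \<open>(u, v)\<close> stands for
  \<open>u + \<i> v\<close>.\<close>

definition cscale :: "complex \<Rightarrow> 'a::real_vector \<times> 'a \<Rightarrow> 'a \<times> 'a" where
  "cscale c = (\<lambda>(u, v). (Re c *\<^sub>R u - Im c *\<^sub>R v, Re c *\<^sub>R v + Im c *\<^sub>R u))"

definition complexify :: "('a \<Rightarrow> 'b) \<Rightarrow> 'a \<times> 'a \<Rightarrow> 'b \<times> 'b" where
  "complexify A = map_prod A A"

definition complexify2 ::
    "('a \<Rightarrow> 'a \<Rightarrow> 'b::real_vector) \<Rightarrow> 'a \<times> 'a \<Rightarrow> 'a \<times> 'a \<Rightarrow> 'b \<times> 'b" where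
  "complexify2 B = (\<lambda>(u, v) (u', v'). (B u u' - B v v', B u v' + B v u'))"

definition complex_eigenvalue :: "('a::real_vector \<Rightarrow> 'a) \<Rightarrow> complex \<Rightarrow> bool" where
  "complex_eigenvalue A c \<longleftrightarrow> (\<exists>w. w \<noteq> 0 \<and> complexify A w = cscale c w)"

definition type_I :: "('s \<Rightarrow> ('h::real_normed_vector \<Rightarrow>\<^sub>L 'h)) \<Rightarrow> bool" where
  "type_I \<rho> \<longleftrightarrow> (\<forall>X c. complex_eigenvalue (\<rho> X) c \<longrightarrow> Re c = 0)"

section \<open>Invariant forms\<close>

text \<open>A \<open>k\<close>-form is a function on lists, vanishing on lists of length other than \<open>k\<close>.\<close>

definition two_form :: "('a::real_vector \<Rightarrow> 'a \<Rightarrow> real) \<Rightarrow> bool" where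
  "two_form \<Omega> \<longleftrightarrow> bilinear \<Omega> \<and> (\<forall>x. \<Omega> x x = 0)"

definition form2 :: "('a \<Rightarrow> 'a \<Rightarrow> 'k::zero) \<Rightarrow> 'a list \<Rightarrow> 'k" where
  "form2 \<Omega> xs = (if length xs = 2 then \<Omega> (xs ! 0) (xs ! 1) else 0)"

text \<open>The Chevalley--Eilenberg differential
  \<open>d\<alpha>(x\<^sub>0,\<dots>,x\<^sub>k) = \<Sum>i<j. (-1)\<^bsup>i+j\<^esup> \<alpha>([x\<^sub>i,x\<^sub>j], x\<^sub>0,\<dots>,x\<^sub>k)\<close> with \<open>x\<^sub>i\<close> and \<open>x\<^sub>j\<close> omitted after the
  bracket.\<close>

definition ce_d :: "('a \<Rightarrow> 'a \<Rightarrow> 'a) \<Rightarrow> ('a list \<Rightarrow> 'k::comm_ring_1) \<Rightarrow> 'a list \<Rightarrow> 'k" where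
  "ce_d br \<alpha> xs = (\<Sum>j<length xs. \<Sum>i<j.
     (-1) ^ (i + j) * \<alpha> (br (xs ! i) (xs ! j) # nths xs (- {i, j})))"

lemma ce_d_form2:
  "ce_d br (form2 \<Omega>) [x, y, z] = - \<Omega> (br x y) z + \<Omega> (br x z) y - \<Omega> (br y z) x"
  by (simp add: ce_d_def form2_def nths_Cons lessThan_Suc numeral_2_eq_2)

definition complex_form2 :: "('a \<Rightarrow> 'a \<Rightarrow> real) \<Rightarrow> ('a \<times> 'a) list \<Rightarrow> complex" where
  "complex_form2 \<omega> = form2 (\<lambda>z w. case complexify2 \<omega> z w of (a, b) \<Rightarrow> Complex a b)"

section \<open>Complex structures\<close>

definition complex_structure ::
    "('a::real_vector \<Rightarrow> 'a \<Rightarrow> 'a) \<Rightarrow> ('a \<Rightarrow> 'a) \<Rightarrow> bool" where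
  "complex_structure br J \<longleftrightarrow> linear J \<and> (\<forall>x. J (J x) = - x) \<and>
     (\<forall>x y. br (J x) (J y) - J (br (J x) y) - J (br x (J y)) - br x y = 0)"

definition proj10 :: "('a::real_vector \<Rightarrow> 'a) \<Rightarrow> 'a \<times> 'a \<Rightarrow> 'a \<times> 'a" where
  "proj10 J z = cscale (1 / 2) (z - cscale \<i> (complexify J z))"

definition proj01 :: "('a::real_vector \<Rightarrow> 'a) \<Rightarrow> 'a \<times> 'a \<Rightarrow> 'a \<times> 'a" where
  "proj01 J z = cscale (1 / 2) (z + cscale \<i> (complexify J z))"

text \<open>The \<open>(p, q)\<close>-component of a form on the complexification, obtained by splitting every argument
  into its \<open>(1, 0)\<close>- and \<open>(0, 1)\<close>-parts and expanding.\<close>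

definition bidegree_part ::
    "('a::real_vector \<Rightarrow> 'a) \<Rightarrow> nat \<Rightarrow> nat \<Rightarrow> (('a \<times> 'a) list \<Rightarrow> complex) \<Rightarrow> ('a \<times> 'a) list \<Rightarrow> complex" where
  "bidegree_part J p q \<alpha> zs = (if length zs = p + q then
     (\<Sum>S | S \<subseteq> {..<p + q} \<and> card S = p.
        \<alpha> (map (\<lambda>i. if i \<in> S then proj10 J (zs ! i) else proj01 J (zs ! i)) [0..<p + q])) else 0)"

text \<open>\<open>\<partial>\<close> and its conjugate on forms of bidegree \<open>(p, q)\<close>.\<close>

definition del ::
    "('a::real_vector \<Rightarrow> 'a \<Rightarrow> 'a) \<Rightarrow> ('a \<Rightarrow> 'a) \<Rightarrow> nat \<Rightarrow> nat \<Rightarrow>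
     (('a \<times> 'a) list \<Rightarrow> complex) \<Rightarrow> ('a \<times> 'a) list \<Rightarrow> complex" where
  "del br J p q \<alpha> = bidegree_part J (p + 1) q (ce_d (complexify2 br) \<alpha>)"

definition delbar ::
    "('a::real_vector \<Rightarrow> 'a \<Rightarrow> 'a) \<Rightarrow> ('a \<Rightarrow> 'a) \<Rightarrow> nat \<Rightarrow> nat \<Rightarrow>
     (('a \<times> 'a) list \<Rightarrow> complex) \<Rightarrow> ('a \<times> 'a) list \<Rightarrow> complex" where
  "delbar br J p q \<alpha> = bidegree_part J p (q + 1) (ce_d (complexify2 br) \<alpha>)"

section \<open>Taming symplectic structures and SKT metrics\<close>

definition taming_symplectic ::
    "('a::real_vector \<Rightarrow> 'a \<Rightarrow> 'a) \<Rightarrow> ('a \<Rightarrow> 'a) \<Rightarrow> ('a \<Rightarrow> 'a \<Rightarrow> real) \<Rightarrow> bool" where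
  "taming_symplectic br J \<Omega> \<longleftrightarrow> two_form \<Omega> \<and> (\<forall>x. (\<forall>y. \<Omega> x y = 0) \<longrightarrow> x = 0) \<and>
     (\<forall>xs. ce_d br (form2 \<Omega>) xs = 0) \<and> (\<forall>x. x \<noteq> 0 \<longrightarrow> \<Omega> x (J x) > 0)"

definition hermitian_metric ::
    "('a::real_vector \<Rightarrow> 'a) \<Rightarrow> ('a \<Rightarrow> 'a \<Rightarrow> real) \<Rightarrow> bool" where
  "hermitian_metric J g \<longleftrightarrow> bilinear g \<and> (\<forall>x y. g x y = g y x) \<and> (\<forall>x. x \<noteq> 0 \<longrightarrow> g x x > 0) \<and>
     (\<forall>x y. g (J x) (J y) = g x y)"

text \<open>The sign is chosen so that the fundamental form of a Hermitian metric satisfies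
  \<open>\<omega>(x, Jx) = g(x, x)\<close>; the SKT condition does not depend on it.\<close>

definition fundamental_form ::
    "('a \<Rightarrow> 'a) \<Rightarrow> ('a \<Rightarrow> 'a \<Rightarrow> real) \<Rightarrow> 'a \<Rightarrow> 'a \<Rightarrow> real" where
  "fundamental_form J g x y = g (J x) y"

text \<open>The fundamental form has bidegree \<open>(1, 1)\<close>.\<close>

definition skt_metric ::
    "('a::real_vector \<Rightarrow> 'a \<Rightarrow> 'a) \<Rightarrow> ('a \<Rightarrow> 'a) \<Rightarrow> ('a \<Rightarrow> 'a \<Rightarrow> real) \<Rightarrow> bool" where
  "skt_metric br J g \<longleftrightarrow> hermitian_metric J g \<and>
     (\<forall>zs. del br J 1 2 (delbar br J 1 1 (complex_form2 (fundamental_form J g))) zs = 0)"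

end

theory Submission
  imports Defs "HOL-Computational_Algebra.Fundamental_Theorem_Algebra"
begin

text \<open>On \<open>(\<hh>, J)\<close>, viewed as a complex vector space, \<open>\<phi>(\<ss>)\<close> is a nilpotent algebra of complex linear
  maps, so it has a common eigenvector \<open>y\<close> whose weight \<open>\<lambda>\<close> has real part \<open>a \<noteq> 0\<close>. Since \<open>\<phi>(\<ss>)\<close> acts by
  derivations, \<open>[y, Jy]\<close> has weight \<open>2a\<close> if it is nonzero; passing to it repeatedly, one may assume
  \<open>[y, Jy] = 0\<close>. For a closed taming form, \<open>0 = d\<Omega>(x, y, Jy) = - 2a(x) \<Omega>(y, Jy)\<close>, a contradiction.
  For an SKT metric, the vanishing of \<open>dd\<^sup>c\<omega>(x, Jx, y, Jy)\<close> gives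
  \<open>a(J[x, Jx]) = 2(a(x)\<^sup>2 + a(Jx)\<^sup>2)\<close> for all \<open>x \<in> \<ss>\<close>. By integrability of \<open>J\<close> this polarises to a
  formula for \<open>a(J[x, x'])\<close>, which says that \<open>(a, a \<circ> J)\<close> is a homomorphism from \<open>\<ss>\<close> onto the nonabelian
  Lie algebra of dimension two, impossible for nilpotent \<open>\<ss>\<close>.\<close>

section \<open>Auxiliary facts on brackets and iterates of linear maps\<close>

lemma lie_bracket_antisym:
  assumes "lie_bracket br"
  shows "br x y = - br y x"
proof -
  have bl: "bilinear br" and alt: "br v v = 0" for v
    using assms by (auto simp: lie_bracket_def)
  have "br x y + br y x = 0"
    using alt[of "x + y"] alt[of x] alt[of y]
    by (simp add: bilinear_ladd[OF bl] bilinear_radd[OF bl] add.commute)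
  then show ?thesis
    by (simp add: eq_neg_iff_add_eq_0)
qed

lemma linear_funpow:
  fixes T :: "'a::real_vector \<Rightarrow> 'a"
  assumes "linear T"
  shows "linear (T ^^ n)"
proof (induction n)
  case (Suc n)
  show ?case
    using linear_compose[OF Suc assms] by (simp add: comp_def)
qed (simp add: linear_id[unfolded id_def] id_def)

lemma funpow_eq_0_mono:
  fixes T :: "'a::real_vector \<Rightarrow> 'a"
  assumes "linear T" "(T ^^ k) x = 0" "k \<le> m"
  shows "(T ^^ m) x = 0"
proof -
  have "(T ^^ m) x = (T ^^ (m - k)) ((T ^^ k) x)"
    using funpow_add[of "m - k" k T] assms(3) by simp
  then show ?thesis
    using assms linear_0[OF linear_funpow] by simp
qed

lemma linear_blinfun_apply: "linear (blinfun_apply A)"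
  by (simp add: blinfun.bounded_linear_right bounded_linear.linear)

section \<open>Complex linear algebra on a real vector space with a complex structure\<close>

locale linear_complex_structure =
  fixes J :: "'a::euclidean_space \<Rightarrow> 'a"
  assumes linear_J: "linear J" and J_J [simp]: "J (J x) = - x"
begin

text \<open>Complex scalar multiplication with \<open>J\<close> as the imaginary unit. The type
  stays real, so all dimensions below are real dimensions.\<close>

definition jscale :: "complex \<Rightarrow> 'a \<Rightarrow> 'a" where
  "jscale c v = Re c *\<^sub>R v + Im c *\<^sub>R J v"

lemmas J_simps [simp] = linear_add[OF linear_J] linear_diff[OF linear_J] linear_cmul[OF linear_J]
  linear_0[OF linear_J] linear_neg[OF linear_J]

lemma jscale_0_left [simp]: "jscale 0 v = 0"
  and jscale_0_right [simp]: "jscale c 0 = 0"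
  and jscale_1 [simp]: "jscale 1 v = v"
  and jscale_add_left: "jscale (c + d) v = jscale c v + jscale d v"
  and jscale_diff_left: "jscale (c - d) v = jscale c v - jscale d v"
  and jscale_add_right: "jscale c (v + w) = jscale c v + jscale c w"
  and jscale_diff_right: "jscale c (v - w) = jscale c v - jscale c w"
  and jscale_scaleR: "jscale c (r *\<^sub>R v) = r *\<^sub>R jscale c v"
  and jscale_jscale: "jscale c (jscale d v) = jscale (c * d) v"
  and J_jscale: "J (jscale c v) = jscale c (J v)"
  and jscale_of_real: "jscale (of_real r) v = r *\<^sub>R v"
  by (simp_all add: jscale_def algebra_simps)

lemma jscale_eq_0_iff: "jscale c v = 0 \<longleftrightarrow> c = 0 \<or> v = 0"
proof
  assume *: "jscale c v = 0"
  show "c = 0 \<or> v = 0"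
  proof (rule disjCI)
    assume "v \<noteq> 0"
    show "c = 0"
    proof (rule ccontr)
      assume "c \<noteq> 0"
      then have "v = jscale (inverse c * c) v"
        by simp
      also have "\<dots> = 0"
        by (simp add: * flip: jscale_jscale)
      finally show False
        using \<open>v \<noteq> 0\<close> by simp
    qed
  qed
qed auto

lemma jscale_in_subspace:
  assumes "subspace W" "J ` W \<subseteq> W" "w \<in> W"
  shows "jscale c w \<in> W"
  using assms by (auto simp: jscale_def intro!: subspace_add subspace_scale)

lemma linear_jscale_right: "linear (jscale c)"
  by (rule linearI) (simp_all add: jscale_add_right jscale_scaleR)

lemma linear_commutes_jscale:
  assumes "linear A" "\<And>v. A (J v) = J (A v)"
  shows "A (jscale c v) = jscale c (A v)"
  using assms by (simp add: jscale_def linear_add linear_cmul)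

text \<open>A root \<open>z\<close> of \<open>p\<close> is split off: either \<open>w\<close> is an
  eigenvector for \<open>z\<close>, or the image of \<open>w\<close> under \<open>A - z\<close> is
  nonzero and annihilated by the quotient, which has smaller degree.\<close>

lemma eigenvector_of_annihilating_poly:
  fixes p :: "complex poly"
  assumes A: "linear A" "\<And>v. A (J v) = J (A v)"
    and W: "subspace W" "A ` W \<subseteq> W" "J ` W \<subseteq> W"
    and "p \<noteq> 0" "degree p \<le> n" "w \<in> W" "w \<noteq> 0"
    and "(\<Sum>i\<le>n. jscale (coeff p i) ((A ^^ i) w)) = 0"
  shows "\<exists>u\<in>W. u \<noteq> 0 \<and> (\<exists>c. A u = jscale c u)"
  using assms(6-)
proof (induction n arbitrary: p w)
  case 0
  then have "coeff p 0 \<noteq> 0"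
    using leading_coeff_0_iff[of p] by auto
  with 0 show ?case
    by (simp add: jscale_eq_0_iff)
next
  case (Suc n)
  show ?case
  \<comment> \<open>A nonzero constant cannot annihilate \<open>w\<close>; every other
    \<open>p\<close> has a root.\<close>
  proof (cases "degree p = 0")
    case True
    then have "coeff p 0 \<noteq> 0"
      using Suc.prems(1) leading_coeff_0_iff[of p] by auto
    moreover have "(\<Sum>i\<le>Suc n. jscale (coeff p i) ((A ^^ i) w)) = jscale (coeff p 0) w"
      using True by (subst sum.atMost_Suc_shift) (simp add: coeff_eq_0)
    ultimately show ?thesis
      using Suc.prems by (simp add: jscale_eq_0_iff)
  next
    case False
    then obtain z where "poly p z = 0"
      using fundamental_theorem_of_algebra[of p] by (auto simp: constant_degree)
    then obtain q where p: "p = [:- z, 1:] * q"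
      by (auto simp: poly_eq_0_iff_dvd dvd_def)
    have q: "q \<noteq> 0"
      using Suc.prems(1) p by auto
    then have degq: "degree q \<le> n"
      using Suc.prems(2) by (simp add: p degree_mult_eq del: mult_pCons_left)
    define u where "u = A w - jscale z w"
    have uW: "u \<in> W"
      using W Suc.prems(3) by (auto simp: u_def intro!: subspace_diff jscale_in_subspace)
    have pow: "(A ^^ i) u = (A ^^ Suc i) w - jscale z ((A ^^ i) w)" for i
    proof (induction i)
      case (Suc i)
      then show ?case
        using A by (simp add: linear_diff linear_commutes_jscale)
    qed (simp add: u_def)
    \<comment> \<open>The coefficient of \<open>p\<close> at \<open>i\<close> is that of
      \<open>q\<close> at \<open>i - 1\<close> minus \<open>z\<close> times that of \<open>q\<close>
      at \<open>i\<close>. Shifting the index in the first sum regroups the terms into iterates of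
      \<open>u\<close>.\<close>
    have "(\<Sum>i\<le>Suc n. jscale (coeff p i) ((A ^^ i) w)) =
        (\<Sum>i\<le>Suc n. jscale (coeff (pCons 0 q) i) ((A ^^ i) w)) -
        (\<Sum>i\<le>Suc n. jscale (z * coeff q i) ((A ^^ i) w))"
      by (simp add: p jscale_add_left jscale_diff_left sum_subtractf)
    also have "(\<Sum>i\<le>Suc n. jscale (z * coeff q i) ((A ^^ i) w)) =
        (\<Sum>i\<le>n. jscale (z * coeff q i) ((A ^^ i) w))"
      using degq by (simp add: coeff_eq_0)
    also have "(\<Sum>i\<le>Suc n. jscale (coeff (pCons 0 q) i) ((A ^^ i) w)) =
        (\<Sum>i\<le>n. jscale (coeff q i) ((A ^^ Suc i) w))"
      by (subst sum.atMost_Suc_shift) simp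
    finally have "(\<Sum>i\<le>n. jscale (coeff q i) ((A ^^ i) u)) = 0"
      using Suc.prems(5)
      by (simp add: pow jscale_diff_right sum_subtractf jscale_jscale mult.commute)
    then have "u \<noteq> 0 \<Longrightarrow> ?thesis"
      using Suc.IH[OF q degq uW] by blast
    moreover have "A w = jscale z w" if "u = 0"
      using that by (simp add: u_def)
    ultimately show ?thesis
      using Suc.prems(3,4) by blast
  qed
qed

text \<open>There is one iterate more than the dimension allows to be independent. Dependence is a
  property of sets, so a repetition among the iterates is a separate case with its own
  relation.\<close>

lemma dependent_orbit:
  fixes A :: "'a \<Rightarrow> 'a"
  shows "\<exists>f. (\<exists>i\<le>DIM('a). f i \<noteq> 0) \<and> (\<Sum>i\<le>DIM('a). f i *\<^sub>R (A ^^ i) w) = 0"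
proof (cases "inj_on (\<lambda>i. (A ^^ i) w) {..DIM('a)}")
  case True
  let ?S = "(\<lambda>i. (A ^^ i) w) ` {..DIM('a)}"
  have "card ?S = DIM('a) + 1"
    using True by (simp add: card_image)
  then have "dependent ?S"
    by (intro dependent_biggerset) auto
  then obtain f v where "v \<in> ?S" "f v \<noteq> 0" "(\<Sum>v\<in>?S. f v *\<^sub>R v) = 0"
    by (auto simp: dependent_finite)
  then show ?thesis
    by (intro exI[of _ "\<lambda>i. f ((A ^^ i) w)"]) (auto simp: sum.reindex[OF True])
next
  case False
  then obtain i j where ij: "i \<le> DIM('a)" "j \<le> DIM('a)" "i \<noteq> j" "(A ^^ i) w = (A ^^ j) w"
    by (auto simp: inj_on_def)
  let ?f = "\<lambda>k. (if k = i then 1 else 0) - (if k = j then 1 else (0::real))"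
  have "(\<Sum>k\<le>DIM('a). ?f k *\<^sub>R (A ^^ k) w) = 0"
    using ij by (simp add: scaleR_diff_left sum_subtractf if_distrib[of "\<lambda>r. r *\<^sub>R _"] sum.delta
      cong: if_cong)
  then show ?thesis
    using ij by (intro exI[of _ ?f]) auto
qed

lemma eigenvector_exists:
  assumes A: "linear A" "\<And>v. A (J v) = J (A v)"
    and W: "subspace W" "A ` W \<subseteq> W" "J ` W \<subseteq> W" and "w \<in> W" "w \<noteq> 0"
  shows "\<exists>u\<in>W. u \<noteq> 0 \<and> (\<exists>c. A u = jscale c u)"
proof -
  obtain f k where f: "k \<le> DIM('a)" "f k \<noteq> 0" "(\<Sum>i\<le>DIM('a). f i *\<^sub>R (A ^^ i) w) = 0"
    using dependent_orbit[of A w] by blast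
  \<comment> \<open>The real relation is read as a complex polynomial, which guarantees
    roots.\<close>
  define p where "p = (\<Sum>i\<le>DIM('a). monom (complex_of_real (f i)) i)"
  have coeff: "coeff p i = (if i \<le> DIM('a) then of_real (f i) else 0)" for i
    by (simp add: p_def coeff_sum)
  have "p \<noteq> 0"
    using f(1,2) coeff[of k] by auto
  moreover have "degree p \<le> DIM('a)"
    by (rule degree_le) (simp add: coeff)
  ultimately show ?thesis
    using f(3) assms by (intro eigenvector_of_annihilating_poly[of A W p "DIM('a)" w])
      (auto simp: coeff jscale_of_real)
qed

text \<open>A bound on \<open>A\<close> bounds its eigenvalues, up to the factor
  \<open>1 + KJ\<close>: the norm is not assumed invariant under \<open>J\<close>.\<close>

lemma eigenvalues_bounded:
  assumes "linear A"
  shows "\<exists>K. \<forall>c w. w \<noteq> 0 \<longrightarrow> A w = jscale c w \<longrightarrow> cmod c \<le> K"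
proof -
  obtain KA where KA: "\<And>v. norm (A v) \<le> norm v * KA" "KA > 0"
    using bounded_linear.pos_bounded[of A] assms by (auto simp: linear_conv_bounded_linear)
  obtain KJ where KJ: "\<And>v. norm (J v) \<le> norm v * KJ" "KJ > 0"
    using bounded_linear.pos_bounded[of J] linear_J by (auto simp: linear_conv_bounded_linear)
  have "cmod c \<le> (1 + KJ) * KA" if w: "w \<noteq> 0" "A w = jscale c w" for c w
  proof (cases "c = 0")
    case False
    \<comment> \<open>Multiplying by \<open>cnj c\<close> replaces \<open>c\<close> by the real
      scalar \<open>(cmod c)\<^sup>2\<close>, whose effect on norms is exact.\<close>
    have "c * cnj c = of_real ((cmod c)\<^sup>2)"
      by (rule complex_norm_square[symmetric])
    then have "(cmod c)\<^sup>2 *\<^sub>R w = jscale (cnj c) (A w)"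
      by (simp add: w jscale_jscale mult.commute[of _ c] jscale_of_real del: of_real_power)
    then have "(cmod c)\<^sup>2 * norm w = norm (jscale (cnj c) (A w))"
      by (metis abs_of_nonneg norm_scaleR zero_le_power2)
    also have "\<dots> \<le> \<bar>Re c\<bar> * norm (A w) + \<bar>Im c\<bar> * norm (J (A w))"
      by (auto simp: jscale_def intro!: norm_triangle_le norm_triangle_le_diff)
    also have "\<dots> \<le> cmod c * norm (A w) + cmod c * (norm (A w) * KJ)"
      using KJ by (intro add_mono mult_mono abs_Re_le_cmod abs_Im_le_cmod) auto
    also have "\<dots> = cmod c * (norm (A w) * (1 + KJ))"
      by (simp add: algebra_simps)
    also have "\<dots> \<le> cmod c * (norm w * KA * (1 + KJ))"
      using KA KJ by (intro mult_left_mono mult_right_mono) auto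
    finally have "(cmod c * norm w) * cmod c \<le> (cmod c * norm w) * ((1 + KJ) * KA)"
      by (simp add: power2_eq_square mult_ac)
    then show ?thesis
      using False w by (subst (asm) mult_le_cancel_left_pos) auto
  qed (use KA KJ in auto)
  then show ?thesis
    by blast
qed

text \<open>Otherwise normalise to \<open>[T, B] = 1\<close> with \<open>T u = 0\<close>. Then \<open>T B\<^sup>n\<^sup>+\<^sup>1 u = (n + 1) B\<^sup>n u\<close>, which for
  large \<open>n\<close> contradicts the boundedness of \<open>T\<close> and \<open>B\<close>.\<close>

lemma scalar_commutator_eq_0:
  assumes A: "linear A" "\<And>v. A (J v) = J (A v)" and B: "linear B" "\<And>v. B (J v) = J (B v)"
    and W: "subspace W" "A ` W \<subseteq> W" "B ` W \<subseteq> W" "J ` W \<subseteq> W" and "w \<in> W" "w \<noteq> 0"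
    and comm: "\<And>v. v \<in> W \<Longrightarrow> A (B v) - B (A v) = jscale c v"
  shows "c = 0"
proof (rule ccontr)
  assume "c \<noteq> 0"
  obtain u \<mu> where u: "u \<in> W" "u \<noteq> 0" "A u = jscale \<mu> u"
    using eigenvector_exists[OF A W(1,2,4)] assms(9,10) by metis
  \<comment> \<open>Subtracting \<open>\<mu>\<close> gives \<open>T u = 0\<close> and leaves the
    commutator with \<open>B\<close> unchanged; dividing by \<open>c\<close> makes that commutator
    the identity on \<open>W\<close>.\<close>
  define T where "T v = jscale (inverse c) (A v - jscale \<mu> v)" for v
  have "linear T"
    unfolding T_def
    using A by (intro linear_compose[OF _ linear_jscale_right, unfolded comp_def]
      linear_compose_sub linear_jscale_right)
  have mem: "(B ^^ n) u \<in> W" for n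
    using u(1) W(3) by (induction n) auto
  have shift: "T (B v) = B (T v) + v" if "v \<in> W" for v
  proof -
    have "T (B v) - B (T v) = jscale (inverse c) (A (B v) - B (A v))"
      using B by (simp add: T_def linear_commutes_jscale jscale_diff_right linear_diff)
    also have "\<dots> = v"
      using comm[OF that] \<open>c \<noteq> 0\<close> by (simp add: jscale_jscale)
    finally show ?thesis
      by (simp add: algebra_simps)
  qed
  have T: "T ((B ^^ Suc n) u) = real (Suc n) *\<^sub>R (B ^^ n) u" for n
  proof (induction n)
    case 0
    show ?case
      using shift[OF u(1)] u(3) B by (simp add: T_def linear_0)
  next
    case (Suc n)
    then show ?case
      using shift[OF mem[of "Suc n"]] B by (simp add: linear_add linear_cmul algebra_simps scaleR_2)
  qed
  have nz: "(B ^^ n) u \<noteq> 0" for n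
  proof (induction n)
    case (Suc n)
    then show ?case
      using T[of n] linear_0[OF \<open>linear T\<close>] by auto
  qed (use u in simp)
  obtain KT where KT: "\<And>v. norm (T v) \<le> norm v * KT" "KT > 0"
    using bounded_linear.pos_bounded[of T] \<open>linear T\<close> by (auto simp: linear_conv_bounded_linear)
  obtain KB where KB: "\<And>v. norm (B v) \<le> norm v * KB" "KB > 0"
    using bounded_linear.pos_bounded[of B] B by (auto simp: linear_conv_bounded_linear)
  obtain n where n: "real n > KB * KT"
    using reals_Archimedean2 by blast
  have "real (Suc n) * norm ((B ^^ n) u) = norm (T ((B ^^ Suc n) u))"
    by (simp only: T norm_scaleR abs_of_nat)
  also have "\<dots> \<le> norm ((B ^^ n) u) * KB * KT"
    using KT(1)[of "(B ^^ Suc n) u"] KB(1)[of "(B ^^ n) u"] KT(2)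
    by (auto intro: order_trans mult_right_mono)
  finally have "norm ((B ^^ n) u) * real (Suc n) \<le> norm ((B ^^ n) u) * (KB * KT)"
    by (simp only: mult_ac)
  then have "real (Suc n) \<le> KB * KT"
    using nz[of n] by (metis mult_le_cancel_left_pos zero_less_norm_iff)
  then show False
    using n by simp
qed

end

section \<open>Common eigenvectors of nilpotent algebras of complex linear maps\<close>

lemma lower_central_series_subset:
  assumes "lie_subalgebra br L"
  shows "lower_central_series br L n \<subseteq> L"
proof (induction n)
  case (Suc n)
  then have "{br x y | x y. x \<in> L \<and> y \<in> lower_central_series br L n} \<subseteq> L"
    using assms by (auto simp: lie_subalgebra_def)
  then show ?case
    using assms by (simp add: lie_subalgebra_def span_minimal)
qed simp

lemma bracket_in_lower_central_series:
  assumes "x \<in> L" "y \<in> lower_central_series br L n"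
  shows "br x y \<in> lower_central_series br L (Suc n)"
  using assms by (auto intro!: span_base)

context linear_complex_structure
begin

text \<open>On a minimal nonzero invariant subspace \<open>W\<close> every element of \<open>L\<close> is a complex scalar, by
  downward induction along the lower central series: if \<open>[B, A]\<close> is scalar on \<open>W\<close> for all \<open>B\<close>, then
  it is zero, so the eigenspaces of \<open>A\<close> in \<open>W\<close> are invariant.\<close>

lemma common_eigenvector:
  fixes L :: "('a \<Rightarrow>\<^sub>L 'a) set"
  assumes L: "lie_subalgebra commutator L" "nilpotent commutator L"
    and LJ: "\<And>A v. A \<in> L \<Longrightarrow> A (J v) = J (A v)"
    and U: "subspace U" "J ` U \<subseteq> U" "\<And>A. A \<in> L \<Longrightarrow> A ` U \<subseteq> U" "U \<noteq> {0}"
  shows "\<exists>w\<in>U. w \<noteq> 0 \<and> (\<forall>A\<in>L. \<exists>c. A w = jscale c w)"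
proof -
  define inv where "inv W \<longleftrightarrow> subspace W \<and> W \<subseteq> U \<and> J ` W \<subseteq> W \<and> (\<forall>A\<in>L. A ` W \<subseteq> W) \<and> W \<noteq> {0}" for W
  have "inv U"
    using U by (auto simp: inv_def)
  then obtain W where W: "inv W" and min: "\<And>W'. inv W' \<Longrightarrow> dim W \<le> dim W'"
    using ex_has_least_nat[of inv U dim] by blast
  have subW: "subspace W" and JW: "J ` W \<subseteq> W" and AW: "\<And>A. A \<in> L \<Longrightarrow> A ` W \<subseteq> W"
    using W by (auto simp: inv_def)
  obtain w where w: "w \<in> W" "w \<noteq> 0"
    using W subspace_0[OF subW] by (auto simp: inv_def)
  note lin = linear_blinfun_apply
  obtain N where N: "lower_central_series commutator L N = {0}"
    using L(2) by (auto simp: nilpotent_def)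
  \<comment> \<open>The induction starts at \<open>N\<close>, where only the zero map is left, and
    ends at 0, where the series is \<open>L\<close> itself.\<close>
  have "\<forall>A\<in>lower_central_series commutator L n. \<exists>c. \<forall>v\<in>W. A v = jscale c v" if "n \<le> N" for n
    using that
  proof (induction n rule: inc_induct)
    case base
    show ?case
      by (auto simp: N intro: exI[of _ 0])
  next
    case (step n)
    show ?case
    proof
      fix A assume A: "A \<in> lower_central_series commutator L n"
      then have AL: "A \<in> L"
        using lower_central_series_subset[OF L(1)] by blast
      have comm: "B (A v) = A (B v)" if B: "B \<in> L" and "v \<in> W" for B v
      proof -
        obtain c where "\<And>v. v \<in> W \<Longrightarrow> commutator B A v = jscale c v"
          using step.IH bracket_in_lower_central_series[OF B A] by blast
        then have c: "\<And>v. v \<in> W \<Longrightarrow> B (A v) - A (B v) = jscale c v"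
          by (simp add: commutator_def blinfun.diff_left)
        have "c = 0"
          by (rule scalar_commutator_eq_0[of "blinfun_apply B" "blinfun_apply A" W w c])
            (use lin LJ AL B subW JW AW w c in auto)
        then show ?thesis
          using c[OF that(2)] by simp
      qed
      obtain u c where u: "u \<in> W" "u \<noteq> 0" "A u = jscale c u"
        using eigenvector_exists[OF lin LJ[OF AL] subW AW[OF AL] JW w] by metis
      \<comment> \<open>All of \<open>L\<close> commutes with \<open>A\<close> on \<open>W\<close>,
        so this eigenspace is invariant and minimality forces it to be \<open>W\<close>.\<close>
      define E where "E = {v \<in> W. A v = jscale c v}"
      have "inv E"
        unfolding inv_def
      proof (intro conjI ballI)
        show "subspace E"
          using subW by (auto simp: subspace_def E_def blinfun.add_right blinfun.scaleR_right
            jscale_add_right jscale_scaleR)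
        show "E \<subseteq> U"
          using W by (auto simp: E_def inv_def)
        show "J ` E \<subseteq> E"
          using JW LJ[OF AL] by (auto simp: E_def J_jscale)
        show "B ` E \<subseteq> E" if "B \<in> L" for B
          using AW[OF that] comm[OF that, symmetric] linear_commutes_jscale[OF lin LJ[OF that]]
          by (auto simp: E_def)
        show "E \<noteq> {0}"
          using u by (auto simp: E_def)
      qed
      then have "E = W"
        using min[of E] subspace_dim_equal[of E W] subW by (auto simp: inv_def E_def)
      then show "\<exists>c. \<forall>v\<in>W. A v = jscale c v"
        by (auto simp: E_def)
    qed
  qed
  from this[of 0] have "\<exists>c. A w = jscale c w" if "A \<in> L" for A
    using w(1) that by auto
  moreover have "w \<in> U"
    using W w(1) by (auto simp: inv_def)
  ultimately show ?thesis
    using w(2) by blast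
qed

text \<open>For \<open>T = A - c\<close> one has \<open>T B = B T + [A, B]\<close>, and
  \<open>[A, B]\<close> lies one step further down the lower central series. This calls for a double
  induction: downward along the series, and on the power of \<open>T\<close> that kills
  \<open>v\<close>.\<close>

lemma generalized_eigenspace_invariant:
  fixes L :: "('a \<Rightarrow>\<^sub>L 'a) set"
  assumes L: "lie_subalgebra commutator L" "nilpotent commutator L"
    and LJ: "\<And>A v. A \<in> L \<Longrightarrow> A (J v) = J (A v)"
    and A: "A \<in> L" and B: "B \<in> L" and v: "((\<lambda>v. A v - jscale c v) ^^ n) v = 0"
  shows "\<exists>m. ((\<lambda>v. A v - jscale c v) ^^ m) (B v) = 0"
proof -
  let ?T = "\<lambda>v. A v - jscale c v"
  note lin = linear_blinfun_apply
  have "linear ?T"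
    by (intro linear_compose_sub lin linear_jscale_right)
  note linT = linear_funpow[OF this] and T_mono = funpow_eq_0_mono[OF this]
  obtain N where N: "lower_central_series commutator L N = {0}"
    using L(2) by (auto simp: nilpotent_def)
  have "\<forall>B\<in>lower_central_series commutator L k. \<forall>n v. (?T ^^ n) v = 0 \<longrightarrow> (\<exists>m. (?T ^^ m) (B v) = 0)"
    if "k \<le> N" for k
    using that
  proof (induction k rule: inc_induct)
    case base
    show ?case
      using linear_0[OF linT] by (auto simp: N)
  next
    case (step k)
    show ?case
    proof (intro ballI allI impI)
      fix B n v assume B: "B \<in> lower_central_series commutator L k" and "(?T ^^ n) v = 0"
      from this(2) show "\<exists>m. (?T ^^ m) (B v) = 0"
      proof (induction n arbitrary: v)
        case 0
        then show ?case
          by (auto intro: exI[of _ 0])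
      next
        case (Suc n)
        have BL: "B \<in> L"
          using B lower_central_series_subset[OF L(1)] by blast
        obtain m1 where m1: "(?T ^^ m1) (B (?T v)) = 0"
          using Suc.IH[OF Suc.prems[unfolded funpow_Suc_right comp_apply]] by blast
        obtain m2 where m2: "(?T ^^ m2) (commutator A B v) = 0"
          using step.IH bracket_in_lower_central_series[OF A B] Suc.prems by blast
        have "?T (B v) = B (?T v) + commutator A B v"
          using linear_commutes_jscale[OF lin LJ[OF BL]]
          by (simp add: commutator_def blinfun.diff_left blinfun.diff_right)
        \<comment> \<open>One application of \<open>?T\<close> turns \<open>B v\<close> into a sum
          of two vectors killed by the powers \<open>m1\<close> and \<open>m2\<close>.\<close>
        then have "(?T ^^ Suc (max m1 m2)) (B v) = 0"
          using T_mono[OF m1, of "max m1 m2"] T_mono[OF m2, of "max m1 m2"] linear_add[OF linT]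
          by (simp only: funpow_Suc_right comp_apply) simp
        then show ?case
          by blast
      qed
    qed
  qed
  from this[of 0] B v show ?thesis
    by auto
qed

text \<open>A prescribed eigenvalue of \<open>A\<close> is kept by searching inside its generalized
  eigenspace, which is invariant under \<open>L\<close>; the plain eigenspace need not be, since
  \<open>A\<close> is not assumed central.\<close>

lemma common_eigenvector_of_eigenvalue:
  fixes L :: "('a \<Rightarrow>\<^sub>L 'a) set"
  assumes L: "lie_subalgebra commutator L" "nilpotent commutator L"
    and LJ: "\<And>A v. A \<in> L \<Longrightarrow> A (J v) = J (A v)"
    and A: "A \<in> L" and u: "u \<noteq> 0" "A u = jscale c u"
  shows "\<exists>w. w \<noteq> 0 \<and> A w = jscale c w \<and> (\<forall>B\<in>L. \<exists>d. B w = jscale d w)"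
proof -
  let ?T = "\<lambda>v. A v - jscale c v"
  note lin = linear_blinfun_apply
  have "linear ?T"
    by (intro linear_compose_sub lin linear_jscale_right)
  note linTn = linear_funpow[OF this] and T_mono = funpow_eq_0_mono[OF this]
  define U where "U = {v. \<exists>n. (?T ^^ n) v = 0}"
  have "subspace U"
    unfolding subspace_def
  proof (intro conjI ballI allI)
    show "0 \<in> U"
      using linear_0[OF linTn] by (auto simp: U_def)
    show "r *\<^sub>R x \<in> U" if "x \<in> U" for r x
      using that linear_cmul[OF linTn] by (auto simp: U_def)
    fix x y assume "x \<in> U" "y \<in> U"
    then obtain m n where "(?T ^^ m) x = 0" "(?T ^^ n) y = 0"
      by (auto simp: U_def)
    then have "(?T ^^ max m n) (x + y) = 0"
      using T_mono[of m x "max m n"] T_mono[of n y "max m n"] linear_add[OF linTn] by simp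
    then show "x + y \<in> U"
      by (auto simp: U_def)
  qed
  moreover have "J ` U \<subseteq> U"
  proof -
    have "(?T ^^ n) (J v) = J ((?T ^^ n) v)" for n v
      by (induction n) (simp_all add: LJ[OF A] J_jscale)
    then show ?thesis
      by (auto simp: U_def) (metis J_simps(4))
  qed
  moreover have "B ` U \<subseteq> U" if "B \<in> L" for B
    using generalized_eigenspace_invariant[OF L LJ A that] by (auto simp: U_def)
  moreover have "u \<in> U"
    using u by (auto simp: U_def intro: exI[of _ 1])
  ultimately obtain w where w: "w \<in> U" "w \<noteq> 0" "\<And>B. B \<in> L \<Longrightarrow> \<exists>d. B w = jscale d w"
    using common_eigenvector[OF L LJ, of U] u(1) by blast
  obtain d where d: "A w = jscale d w"
    using w(3)[OF A] by blast
  \<comment> \<open>Membership in \<open>U\<close> makes some power of \<open>d - c\<close>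
    vanish.\<close>
  have "(?T ^^ n) w = jscale ((d - c) ^ n) w" for n
    by (induction n) (simp_all add: linear_commutes_jscale[OF lin LJ[OF A]] d jscale_jscale
        algebra_simps jscale_diff_left)
  then have "d = c"
    using w(1,2) by (auto simp: U_def jscale_eq_0_iff)
  then show ?thesis
    using w d by auto
qed

text \<open>If \<open>y\<close> has weight \<open>\<lambda>\<close>, then \<open>[y, Jy]\<close> is zero or has weight \<open>2 Re \<lambda>\<close>. Since eigenvalues are
  bounded, iterating ends with a vector commuting with its image under \<open>J\<close>.\<close>

lemma commuting_eigenvector:
  assumes br: "lie_bracket br" and D: "\<And>A. A \<in> L \<Longrightarrow> A \<in> Der br"
    and LJ: "\<And>A v. A \<in> L \<Longrightarrow> A (J v) = J (A v)"
    and A: "A \<in> L" and y: "y \<noteq> 0" "A y = jscale c y" "Re c \<noteq> 0"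
    and ev: "\<And>B. B \<in> L \<Longrightarrow> \<exists>d. B y = jscale d y"
  shows "\<exists>w c. w \<noteq> 0 \<and> br w (J w) = 0 \<and> A w = jscale c w \<and> Re c \<noteq> 0 \<and> (\<forall>B\<in>L. \<exists>d. B w = jscale d w)"
proof (rule ccontr)
  assume contr: "\<not> ?thesis"
  have bl: "bilinear br" and alt: "br x x = 0" for x
    using br by (auto simp: lie_bracket_def)
  note lin = linear_blinfun_apply
  note bl_simps = bilinear_ladd[OF bl] bilinear_radd[OF bl] bilinear_lmul[OF bl] bilinear_rmul[OF bl]
    bilinear_lneg[OF bl] bilinear_rneg[OF bl]
    bilinear_lsub[OF bl] bilinear_rsub[OF bl]
  \<comment> \<open>In the Leibniz rule the imaginary part of \<open>d\<close> contributes only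
    \<open>[J w, J w]\<close> and \<open>[w, w]\<close>, while the real part enters once from each
    factor.\<close>
  have weight: "B (br w (J w)) = jscale (2 * Re d) (br w (J w))" if "B \<in> L" "B w = jscale d w" for B w d
  proof -
    have anti: "br (J w) w = - br w (J w)"
      by (rule lie_bracket_antisym[OF br])
    show ?thesis
      using D[OF that(1)] LJ[OF that(1), of w]
      by (simp add: Der_def that(2) jscale_def bl_simps alt anti flip: scaleR_2)
  qed
  \<comment> \<open>\<open>c0\<close> names the fixed eigenvalue, which the bound \<open>c\<close>
    hides. Each passage to \<open>[w, J w]\<close> doubles the real part.\<close>
  have "\<exists>w c. w \<noteq> 0 \<and> A w = jscale c w \<and> \<bar>Re c\<bar> \<ge> 2 ^ n * \<bar>Re (c0)\<bar> \<and> (\<forall>B\<in>L. \<exists>d. B w = jscale d w)"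
    if "c0 = c" for n c0
  proof (induction n)
    case 0
    then show ?case
      using y ev that by auto
  next
    case (Suc n)
    then obtain w d where w: "w \<noteq> 0" "A w = jscale d w" "\<bar>Re d\<bar> \<ge> 2 ^ n * \<bar>Re c0\<bar>"
      "\<And>B. B \<in> L \<Longrightarrow> \<exists>d. B w = jscale d w"
      by blast
    have "Re d \<noteq> 0"
      using w(3) y(3) that by (auto simp: mult_le_0_iff simp flip: not_less)
    then have "br w (J w) \<noteq> 0"
      using contr w by blast
    moreover have "\<exists>d. B (br w (J w)) = jscale d (br w (J w))" if "B \<in> L" for B
      using weight[OF that] w(4)[OF that] by blast
    ultimately show ?case
      using weight[OF A w(2)] w(3)
      by (intro exI[of _ "br w (J w)"] exI[of _ "of_real (2 * Re d)"]) (auto simp: abs_mult)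
  qed
  note * = this[OF refl]
  obtain K where K: "\<And>c w. w \<noteq> 0 \<Longrightarrow> A w = jscale c w \<Longrightarrow> cmod c \<le> K"
    using eigenvalues_bounded[OF lin[of A]] by blast
  obtain n where "K / \<bar>Re c\<bar> < 2 ^ n"
    using real_arch_pow[of 2] by auto
  then have "K < 2 ^ n * \<bar>Re c\<bar>"
    using y(3) by (simp add: field_simps)
  moreover obtain w d where "w \<noteq> 0" "A w = jscale d w" "\<bar>Re d\<bar> \<ge> 2 ^ n * \<bar>Re c\<bar>"
    using *[of n] by blast
  ultimately show False
    using K[of w d] abs_Re_le_cmod[of d] by linarith
qed

text \<open>Sending \<open>u + i v\<close> in the complexification to \<open>u + J v\<close> is
  complex linear, and sending it to \<open>u - J v\<close> is conjugate linear. The images have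
  eigenvalue \<open>c\<close> and \<open>cnj c\<close>, with the same real part, and they do not
  both vanish.\<close>

lemma eigenvector_of_complex_eigenvalue:
  assumes A: "linear A" "\<And>v. A (J v) = J (A v)" and "complex_eigenvalue A c"
  shows "\<exists>u d. u \<noteq> 0 \<and> A u = jscale d u \<and> Re d = Re c"
proof -
  obtain u v where uv: "(u, v) \<noteq> 0" "A u = Re c *\<^sub>R u - Im c *\<^sub>R v" "A v = Re c *\<^sub>R v + Im c *\<^sub>R u"
    using assms(3) by (auto simp: complex_eigenvalue_def complexify_def cscale_def)
  have 1: "A (u + J v) = jscale c (u + J v)"
    using uv A by (simp add: linear_add jscale_def algebra_simps)
  have 2: "A (u - J v) = jscale (cnj c) (u - J v)"
    using uv A by (simp add: linear_diff jscale_def algebra_simps)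
  have "u + J v \<noteq> 0 \<or> u - J v \<noteq> 0"
  proof (rule ccontr)
    assume "\<not> ?thesis"
    then have "u + J v = 0" "u - J v = 0"
      by auto
    then have "2 *\<^sub>R u = 0" "2 *\<^sub>R J v = 0"
      by (simp_all add: scaleR_2 algebra_simps eq_neg_iff_add_eq_0)
    then have "u = 0" "J (J v) = J 0"
      by simp_all
    then show False
      using uv(1) by (simp add: zero_prod_def)
  qed
  then show ?thesis
  proof
    assume "u + J v \<noteq> 0"
    with 1 show ?thesis
      by blast
  next
    assume "u - J v \<noteq> 0"
    moreover have "Re (cnj c) = Re c"
      by simp
    ultimately show ?thesis
      using 2 by blast
  qed
qed

end

section \<open>The SKT condition on vectors of pure type\<close>

lemma ce_d_3:
  "ce_d br \<alpha> [x, y, z] = - \<alpha> [br x y, z] + \<alpha> [br x z, y] - \<alpha> [br y z, x]"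
  by (simp add: ce_d_def nths_Cons lessThan_Suc numeral_2_eq_2)

lemma ce_d_4:
  "ce_d br \<alpha> [x, y, z, w] = - \<alpha> [br x y, z, w] + \<alpha> [br x z, y, w] - \<alpha> [br x w, y, z]
     - \<alpha> [br y z, x, w] + \<alpha> [br y w, x, z] - \<alpha> [br z w, x, y]"
  by (simp add: ce_d_def nths_Cons lessThan_Suc numeral_2_eq_2 numeral_3_eq_3)

lemma bidegree_part_1_2:
  "bidegree_part J 1 2 \<alpha> [x, y, z] =
     \<alpha> [proj10 J x, proj01 J y, proj01 J z] + \<alpha> [proj01 J x, proj10 J y, proj01 J z] +
     \<alpha> [proj01 J x, proj01 J y, proj10 J z]"
proof -
  have "{S. S \<subseteq> {..<3::nat} \<and> card S = 1} = {{0}, {1}, {2}}"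
    by (auto simp: card_1_singleton_iff)
  then show ?thesis
    by (simp add: bidegree_part_def upt_rec[of _ 3] upt_rec[of _ "Suc _"] numeral_3_eq_3
        numeral_2_eq_2 add.assoc)
qed

lemma bidegree_part_2_2:
  "bidegree_part J 2 2 \<alpha> [x, y, z, w] =
     \<alpha> [proj10 J x, proj10 J y, proj01 J z, proj01 J w] +
     \<alpha> [proj10 J x, proj01 J y, proj10 J z, proj01 J w] +
     \<alpha> [proj10 J x, proj01 J y, proj01 J z, proj10 J w] +
     \<alpha> [proj01 J x, proj10 J y, proj10 J z, proj01 J w] +
     \<alpha> [proj01 J x, proj10 J y, proj01 J z, proj10 J w] +
     \<alpha> [proj01 J x, proj01 J y, proj10 J z, proj10 J w]"
proof -
  have "{S. S \<subseteq> {..<4::nat} \<and> card S = 2} = {{0, 1}, {0, 2}, {0, 3}, {1, 2}, {1, 3}, {2, 3}}"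
  proof (intro equalityI subsetI)
    fix S assume S: "S \<in> {S. S \<subseteq> {..<4::nat} \<and> card S = 2}"
    then obtain i j where "S = {i, j}" "i \<noteq> j" "i < 4" "j < 4"
      by (auto simp: card_2_iff)
    then show "S \<in> {{0, 1}, {0, 2}, {0, 3}, {1, 2}, {1, 3}, {2, 3}}"
      by (auto simp: less_Suc_eq eval_nat_numeral insert_commute)
  qed auto
  moreover have "[0..<4] = [0, 1, 2, 3::nat]"
    by (simp add: upt_rec)
  ultimately show ?thesis
    by (simp add: bidegree_part_def doubleton_eq_iff add.assoc)
qed

lemma proj10_Pair: "proj10 J (p, q) = ((1/2) *\<^sub>R (p + J q), (1/2) *\<^sub>R (q - J p))"
  and proj01_Pair: "proj01 J (p, q) = ((1/2) *\<^sub>R (p - J q), (1/2) *\<^sub>R (q + J p))"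
  by (simp_all add: proj10_def proj01_def cscale_def complexify_def)

text \<open>Write \<open>Z = x - \<i>Jx\<close> and \<open>U = y - \<i>Jy\<close>, with conjugates \<open>Z'\<close> and \<open>U'\<close>. These four vectors are of
  pure type, so a single term survives in the \<open>(2, 2)\<close>-part of the SKT condition evaluated at
  \<open>(Z, Z', U, U')\<close>, and up to a nonzero multiple of \<open>g(y, y)\<close> it is the stated identity.\<close>

lemma skt_weight_identity:
  assumes br: "lie_bracket br" and J: "complex_structure br J" and skt: "skt_metric br J g"
    and y: "y \<noteq> 0" "br y (J y) = 0"
    and x: "br x y = a *\<^sub>R y + b *\<^sub>R J y" "br x (J y) = a *\<^sub>R J y - b *\<^sub>R y"
    and Jx: "br (J x) y = a' *\<^sub>R y + b' *\<^sub>R J y" "br (J x) (J y) = a' *\<^sub>R J y - b' *\<^sub>R y"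
    and w: "br (br x (J x)) y = 0" "br (br x (J x)) (J y) = 0"
    and Jw: "br (J (br x (J x))) y = c *\<^sub>R y + d *\<^sub>R J y"
      "br (J (br x (J x))) (J y) = c *\<^sub>R J y - d *\<^sub>R y"
  shows "c = 2 * (a\<^sup>2 + a'\<^sup>2)"
proof -
  have bl: "bilinear br" and alt: "br x x = 0" for x
    using br by (auto simp: lie_bracket_def)
  have lJ: "linear J" and JJ: "J (J x) = - x" for x
    using J by (auto simp: complex_structure_def)
  have gb: "bilinear g" and gsym: "g x y = g y x" and gpos: "x \<noteq> 0 \<Longrightarrow> g x x > 0"
    and gJ: "g (J x) (J y) = g x y" for x y
    using skt by (auto simp: skt_metric_def hermitian_metric_def)
  have dd: "del br J 1 2 (delbar br J 1 1 (complex_form2 (fundamental_form J g))) zs = 0" for zs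
    using skt by (auto simp: skt_metric_def)
  note anti = lie_bracket_antisym[OF br]
  note [simp] = bilinear_ladd[OF bl] bilinear_radd[OF bl] bilinear_lmul[OF bl] bilinear_rmul[OF bl]
    bilinear_lneg[OF bl] bilinear_rneg[OF bl] bilinear_lsub[OF bl] bilinear_rsub[OF bl]
    bilinear_lzero[OF bl] bilinear_rzero[OF bl]
    bilinear_ladd[OF gb] bilinear_radd[OF gb] bilinear_lmul[OF gb] bilinear_rmul[OF gb]
    bilinear_lneg[OF gb] bilinear_rneg[OF gb] bilinear_lsub[OF gb] bilinear_rsub[OF gb]
    bilinear_lzero[OF gb] bilinear_rzero[OF gb]
    linear_add[OF lJ] linear_diff[OF lJ] linear_cmul[OF lJ] linear_0[OF lJ] linear_neg[OF lJ] JJ alt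
  have gyJy: "g y (J y) = 0" "g (J y) y = 0"
    using gJ[of y "J y"] gsym[of "J y" y] by simp_all
  define T where "T u v w = ce_d (complexify2 br) (complex_form2 (fundamental_form J g)) [u, v, w]"
    for u v w
  define \<eta> where "\<eta> = delbar br J 1 1 (complex_form2 (fundamental_form J g))"
  define D where "D = ce_d (complexify2 br) \<eta>"
  define Z where "Z = (x, - J x)"
  define Z' where "Z' = (x, J x)"
  define U where "U = (y, - J y)"
  define U' where "U' = (y, J y)"
  have half: "(1/2) *\<^sub>R (v + v) = v" "(1/2) *\<^sub>R (- v - v) = - v" for v :: 'a
    using scaleR_half_double[of "- v"] by simp_all
  have fixed: "proj10 J (p, - J p) = (p, - J p)" "proj01 J (p, J p) = (p, J p)" for p
    by (simp_all add: proj10_Pair proj01_Pair half)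
  have PQ: "proj10 J Z = Z" "proj01 J Z = 0" "proj10 J Z' = 0" "proj01 J Z' = Z'"
    "proj10 J U = U" "proj01 J U = 0" "proj10 J U' = 0" "proj01 J U' = U'"
    by (simp_all add: Z_def Z'_def U_def U'_def proj10_Pair proj01_Pair half zero_prod_def)
  have P0: "proj10 J 0 = 0" "proj01 J 0 = 0"
    by (simp_all add: zero_prod_def proj10_Pair proj01_Pair)
  have c0: "complexify2 br 0 v = 0" "complexify2 br v 0 = 0" for v
    by (cases v; simp add: complexify2_def zero_prod_def)+
  have T: "T u v w =
      - (case complexify2 (fundamental_form J g) (complexify2 br u v) w of (a, b) \<Rightarrow> Complex a b)
      + (case complexify2 (fundamental_form J g) (complexify2 br u w) v of (a, b) \<Rightarrow> Complex a b)
      - (case complexify2 (fundamental_form J g) (complexify2 br v w) u of (a, b) \<Rightarrow> Complex a b)" for u v w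
    by (simp add: T_def ce_d_3 complex_form2_def form2_def)
  have T0: "T 0 v w = 0" "T u 0 w = 0" "T u v 0 = 0" for u v w
    by (cases u; cases v; cases w;
      simp add: T complexify2_def zero_prod_def fundamental_form_def zero_complex.code)+
  have \<eta>: "\<eta> [u, v, w] = T (proj10 J u) (proj01 J v) (proj01 J w) +
      T (proj01 J u) (proj10 J v) (proj01 J w) + T (proj01 J u) (proj01 J v) (proj10 J w)" for u v w
    by (simp only: \<eta>_def delbar_def T_def one_add_one bidegree_part_1_2)
  have \<eta>0: "\<eta> [0, v, w] = 0" "\<eta> [u, 0, w] = 0" "\<eta> [u, v, 0] = 0" for u v w
    by (simp_all add: \<eta> P0 T0)
  have D0: "D [0, v, w, s] = 0" "D [u, 0, w, s] = 0" "D [u, v, 0, s] = 0" "D [u, v, w, 0] = 0"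
    for u v w s
    by (simp_all add: D_def ce_d_4 c0 \<eta>0)
  have "D [Z, Z', U, U'] = bidegree_part J 2 2 D [Z, Z', U, U']"
    by (simp add: bidegree_part_2_2 PQ D0)
  also have "\<dots> = 0"
    using dd by (simp only: del_def D_def \<eta>_def one_add_one)
  finally have 0: "D [Z, Z', U, U'] = 0" .
  have UU': "complexify2 br U U' = 0"
    using y anti[of "J y" y] by (simp add: U_def U'_def complexify2_def zero_prod_def)
  \<comment> \<open>Weights act complex linearly on \<open>y\<close>, so bracketing with
    \<open>U\<close> gives type (1,0) again, and bracketing with \<open>U'\<close> gives type
    (0,1).\<close>
  have Z'U: "proj01 J (complexify2 br Z' U) = 0"
    using x Jx by (simp add: Z'_def U_def complexify2_def proj01_Pair zero_prod_def)
  \<comment> \<open>Of the six brackets, \<open>[U, U']\<close> is zero, \<open>[Z', U]\<close>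
    lacks the (0,1)-part needed next to \<open>Z\<close> and \<open>U'\<close>, and
    \<open>[Z', U']\<close> meets two vectors of type (1,0), where \<open>\<eta>\<close>, of type
    (1,2), vanishes.\<close>
  have "D [Z, Z', U, U'] = - T (proj01 J (complexify2 br Z Z')) U U' + T (proj10 J (complexify2 br Z U)) Z' U'
      - T (proj01 J (complexify2 br Z U')) Z' U"
    by (simp add: D_def ce_d_4 \<eta> PQ T0 UU' P0 Z'U)
  also have "proj01 J (complexify2 br Z Z') = (- J (br x (J x)), br x (J x))"
    using anti[of "J x" x] by (simp add: Z_def Z'_def complexify2_def proj01_Pair flip: scaleR_2)
  also have "proj10 J (complexify2 br Z U) = ((a + b') *\<^sub>R y + (b - a') *\<^sub>R J y, (b - a') *\<^sub>R y - (a + b') *\<^sub>R J y)"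
  proof -
    have "complexify2 br Z U = (let p = (a + b') *\<^sub>R y + (b - a') *\<^sub>R J y in (p, - J p))"
      by (simp add: Z_def U_def complexify2_def x Jx algebra_simps)
    then show ?thesis
      by (simp only: Let_def fixed) simp
  qed
  also have "proj01 J (complexify2 br Z U') = ((a - b') *\<^sub>R y + (b + a') *\<^sub>R J y, (a - b') *\<^sub>R J y - (b + a') *\<^sub>R y)"
  proof -
    have "complexify2 br Z U' = (let p = (a - b') *\<^sub>R y + (b + a') *\<^sub>R J y in (p, J p))"
      by (simp add: Z_def U'_def complexify2_def x Jx algebra_simps)
    then show ?thesis
      by (simp only: Let_def fixed) simp
  qed
  \<comment> \<open>The imaginary parts \<open>b\<close>, \<open>b'\<close> and \<open>d\<close> of
    the weights have dropped out.\<close>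
  finally have "c * (g y y * 4) = a * (a * (g y y * 8)) + a' * (a' * (g y y * 8))"
    using 0
    by (simp add: T Z_def Z'_def U_def U'_def complexify2_def x Jx w Jw y fundamental_form_def
        gyJy gJ anti[of y x] anti[of "J y" x] anti[of y "J x"] anti[of "J y" "J x"]
        anti[of "J y" y] complex_eq_iff algebra_simps)
  then have "g y y * c = g y y * (2 * (a\<^sup>2 + a'\<^sup>2))"
    by (simp add: power2_eq_square algebra_simps)
  then show ?thesis
    using gpos[OF y(1)] by simp
qed

section \<open>Obstructions from closedness and from nilpotency\<close>

lemma taming_weight_zero:
  assumes J: "linear J" "\<And>x. J (J x) = - x" and "taming_symplectic br J \<Omega>"
    and y: "y \<noteq> 0" "br y (J y) = 0"
    and x: "br x y = a *\<^sub>R y + b *\<^sub>R J y" "br x (J y) = a *\<^sub>R J y - b *\<^sub>R y"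
  shows "a = 0"
proof -
  have bl: "bilinear \<Omega>" and alt: "\<Omega> v v = 0" and pos: "v \<noteq> 0 \<Longrightarrow> \<Omega> v (J v) > 0"
    and closed: "ce_d br (form2 \<Omega>) vs = 0" for v vs
    using assms(3) by (auto simp: taming_symplectic_def two_form_def)
  note bl_simps = bilinear_ladd[OF bl] bilinear_radd[OF bl] bilinear_lmul[OF bl]
    bilinear_rmul[OF bl] bilinear_lsub[OF bl] bilinear_lzero[OF bl]
  have "\<Omega> y (J y) + \<Omega> (J y) y = 0"
    using alt[of "y + J y"] alt[of y] alt[of "J y"] by (simp add: bl_simps add.commute)
  \<comment> \<open>The imaginary part \<open>b\<close> contributes only \<open>\<Omega> y y\<close>
    and \<open>\<Omega> (J y) (J y)\<close>, and \<open>[y, J y] = 0\<close> removes the third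
    term.\<close>
  moreover have "a * \<Omega> y (J y) = a * \<Omega> (J y) y"
    using closed[of "[x, y, J y]"] by (auto simp: ce_d_form2 x y bl_simps alt)
  ultimately have "2 * (a * \<Omega> y (J y)) = 0"
    by (metis distrib_left mult_2 mult_zero_right)
  then show ?thesis
    using pos[OF y(1)] by simp
qed

text \<open>If \<open>a x\<close> is nonzero, bracketing with \<open>x\<close> multiplies the values
  of \<theta> on the kernel of \<open>a\<close> by the nonzero number \<open>- 2 * a x\<close>.
  Starting from \<open>[x, J x]\<close>, where \<theta> is positive, the iterated brackets never
  vanish.\<close>

lemma nilpotent_functional_zero:
  fixes br :: "'a::real_vector \<Rightarrow> 'a \<Rightarrow> 'a" and a :: "'a \<Rightarrow> real"
  assumes br: "lie_bracket br" "nilpotent br UNIV" and J: "complex_structure br J"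
    and a: "linear a" "\<And>x y. a (br x y) = 0"
    and id: "\<And>x. a (J (br x (J x))) = 2 * ((a x)\<^sup>2 + (a (J x))\<^sup>2)"
  shows "a x = 0"
proof (rule ccontr)
  assume "a x \<noteq> 0"
  have bl: "bilinear br"
    using br by (auto simp: lie_bracket_def)
  have lJ: "linear J" and JJ: "J (J x) = - x"
    and integ: "br (J x) (J y) - J (br (J x) y) - J (br x (J y)) - br x y = 0" for x y
    using J by (auto simp: complex_structure_def)
  note lin = bilinear_ladd[OF bl] bilinear_radd[OF bl] bilinear_lneg[OF bl] bilinear_rneg[OF bl]
    linear_add[OF lJ] linear_neg[OF lJ] linear_diff[OF lJ]
    linear_add[OF a(1)] linear_neg[OF a(1)] linear_diff[OF a(1)] linear_0[OF a(1)] linear_0[OF lJ]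
  note anti = lie_bracket_antisym[OF br(1)]
  define \<theta> where "\<theta> v = a (J v)" for v
  have \<theta>J: "\<theta> (J v) = - a v" for v
    by (simp add: \<theta>_def JJ lin)
  have \<theta>_add: "\<theta> (u + v) = \<theta> u + \<theta> v" and \<theta>_neg: "\<theta> (- u) = - \<theta> u" for u v
    by (simp_all add: \<theta>_def lin)
  \<comment> \<open>Applying \<theta> to the integrability condition turns its two middle terms into
    values of \<open>a\<close> on brackets, which are zero.\<close>
  have inv: "\<theta> (br (J u) (J v)) = \<theta> (br u v)" for u v
  proof -
    have "\<theta> (br (J u) (J v) - J (br (J u) v) - J (br u (J v)) - br u v) = 0"
      by (simp add: integ) (simp add: \<theta>_def lin)
    then show ?thesis
      by (simp add: \<theta>_def lin JJ a(2))
  qed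
  \<comment> \<open>The bilinear expression \<open>\<theta> (br u (J v))\<close> is symmetric, hence
    determined by its diagonal, which \<open>id\<close> provides.\<close>
  have sym: "\<theta> (br v (J u)) = \<theta> (br u (J v))" for u v
    using inv[of v "J u"] anti[of "J v" u] by (simp add: JJ lin \<theta>_neg)
  have polar: "\<theta> (br u (J v)) = 2 * (a u * a v + \<theta> u * \<theta> v)" for u v
    using id[of "u + v"] id[of u] id[of v] sym[of u v]
    by (simp add: \<theta>_def[symmetric] lin \<theta>_add power2_eq_square algebra_simps)
  \<comment> \<open>The argument \<open>- J z\<close> is chosen because \<open>J\<close> maps it to
    \<open>z\<close>, and its \<theta>-value is \<open>a z = 0\<close>.\<close>
  have bracket: "\<theta> (br x z) = - 2 * a x * \<theta> z" if "a z = 0" for z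
    using polar[of x "- J z"] that by (simp add: lin JJ \<theta>J \<theta>_neg \<theta>_def[symmetric])
  define z where "z n = (br x ^^ n) (br x (J x))" for n
  have az: "a (z n) = 0" for n
    by (cases n) (simp_all add: z_def a(2))
  have "\<theta> (z n) \<noteq> 0" for n
  proof (induction n)
    case 0
    then show ?case
      using id[of x] \<open>a x \<noteq> 0\<close> by (auto simp: z_def \<theta>_def sum_power2_eq_zero_iff simp del: distrib_left_numeral)
  next
    case (Suc n)
    then show ?case
      using bracket[OF az[of n]] \<open>a x \<noteq> 0\<close> by (simp add: z_def)
  qed
  moreover have "z n \<in> lower_central_series br UNIV n" for n
    by (induction n) (auto simp: z_def intro: span_base)
  moreover obtain n where "lower_central_series br UNIV n = {0}"
    using br(2) by (auto simp: nilpotent_def)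
  ultimately show False
    by (metis \<theta>_def lin(11,12) singletonD)
qed

section \<open>Construction of the weight vector and conclusion of both claims\<close>

theorem theorem1p1:
  fixes brs :: "'s::euclidean_space \<Rightarrow> 's \<Rightarrow> 's"
    and brh :: "'h::euclidean_space \<Rightarrow> 'h \<Rightarrow> 'h"
    and \<phi> :: "'s \<Rightarrow> ('h \<Rightarrow>\<^sub>L 'h)"
    and br :: "'s \<times> 'h \<Rightarrow> 's \<times> 'h \<Rightarrow> 's \<times> 'h"
    and J :: "'s \<times> 'h \<Rightarrow> 's \<times> 'h"
  assumes "lie_bracket brs" and "solvable brs UNIV"
    and "lie_bracket brh"
    and "lie_representation brs \<phi>" and "range \<phi> \<subseteq> Der brh"
    and "br = semidirect_bracket brs brh \<phi>"
    and "complex_structure br J"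
    and "\<not> type_I \<phi>"
    and "lie_subalgebra commutator (range \<phi>)" and "nilpotent commutator (range \<phi>)"
    and "J ` ({0} \<times> UNIV) \<subseteq> {0} \<times> UNIV"
    and "\<forall>X. restrict_h J \<circ> blinfun_apply (\<phi> X) = blinfun_apply (\<phi> X) \<circ> restrict_h J"
  shows "\<not> (\<exists>\<Omega>. taming_symplectic br J \<Omega>) \<and>
    (nilpotent brs UNIV \<and> J ` (UNIV \<times> {0}) \<subseteq> UNIV \<times> {0} \<longrightarrow> \<not> (\<exists>g. skt_metric br J g))"
proof -
  define Jh where "Jh = restrict_h J"
  have lJ: "linear J" and JJ: "J (J x) = - x"
    and integ: "br (J x) (J y) - J (br (J x) y) - J (br x (J y)) - br x y = 0" for x y
    using assms(7) unfolding complex_structure_def by blast+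
  have J0: "J (0, Y) = (0, Jh Y)" for Y
  proof -
    have "J (0, Y) \<in> {0} \<times> UNIV"
      using assms(11) by auto
    then show ?thesis
      by (cases "J (0, Y)") (simp add: Jh_def restrict_h_def)
  qed
  interpret linear_complex_structure Jh
  proof (rule linear_complex_structure.intro)
    show "linear Jh"
    proof (rule linearI)
      fix Y Y' r
      show "Jh (Y + Y') = Jh Y + Jh Y'"
        using linear_add[OF lJ, of "(0, Y)" "(0, Y')"] by (simp add: J0)
      show "Jh (r *\<^sub>R Y) = r *\<^sub>R Jh Y"
        using linear_cmul[OF lJ, of r "(0, Y)"] by (simp add: J0)
    qed
    show "Jh (Jh Y) = - Y" for Y
      using JJ[of "(0, Y)"] by (simp add: J0)
  qed
  have comm: "A (Jh v) = Jh (A v)" if "A \<in> range \<phi>" for A v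
    using assms(12) that by (auto simp: Jh_def fun_eq_iff)
  have bls: "bilinear brs" and blh: "bilinear brh"
    using assms(1,3) by (auto simp: lie_bracket_def)
  have l\<phi>: "linear \<phi>" and \<phi>br: "\<phi> (brs X X') = commutator (\<phi> X) (\<phi> X')" for X X'
    using assms(4) by (auto simp: lie_representation_def)
  obtain X0 c0 where c0: "complex_eigenvalue (\<phi> X0) c0" "Re c0 \<noteq> 0"
    using assms(8) by (auto simp: type_I_def)
  \<comment> \<open>Three refinements keep the real part at \<open>X0\<close> nonzero: an
    eigenvector for \<open>Jh\<close>, a common eigenvector with the same eigenvalue at
    \<open>X0\<close>, and one commuting with its image under \<open>Jh\<close>, whose eigenvalue
    may differ.\<close>
  obtain u c1 where u: "u \<noteq> 0" "\<phi> X0 u = jscale c1 u" "Re c1 = Re c0"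
    using eigenvector_of_complex_eigenvalue[OF linear_blinfun_apply comm[OF rangeI] c0(1)] by auto
  obtain u' where u': "u' \<noteq> 0" "\<phi> X0 u' = jscale c1 u'" "\<forall>B\<in>range \<phi>. \<exists>d. B u' = jscale d u'"
    using common_eigenvector_of_eigenvalue[OF assms(9,10) comm rangeI u(1,2)] by auto
  have c1: "Re c1 \<noteq> 0"
    using c0(2) u(3) by simp
  obtain Y c where Y: "Y \<noteq> 0" "brh Y (Jh Y) = 0" "\<phi> X0 Y = jscale c Y" "Re c \<noteq> 0"
    and "\<forall>B\<in>range \<phi>. \<exists>d. B Y = jscale d Y"
    using commuting_eigenvector[OF assms(3) subsetD[OF assms(5)] comm rangeI[of \<phi> X0] u'(1,2) c1 bspec[OF u'(3)]]
    by auto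
  then have "\<exists>d. \<phi> X Y = jscale d Y" for X
    by blast
  then obtain wt where wt: "\<And>X. \<phi> X Y = jscale (wt X) Y"
    by metis
  define y where "y = (0::'s, Y)"
  have y: "y \<noteq> 0" "br y (J y) = 0"
    using Y by (simp_all add: y_def J0 assms(6) semidirect_bracket_def zero_prod_def
        bilinear_lzero[OF bls] linear_0[OF l\<phi>])
  have weight: "br (X, 0) y = Re (wt X) *\<^sub>R y + Im (wt X) *\<^sub>R J y"
    "br (X, 0) (J y) = Re (wt X) *\<^sub>R J y - Im (wt X) *\<^sub>R y" for X
    by (simp_all add: y_def J0 assms(6) semidirect_bracket_def bilinear_rzero[OF bls]
        bilinear_lzero[OF blh] comm wt jscale_def)
  \<comment> \<open>Since \<open>Y\<close> is nonzero, the scalars chosen as \<open>wt\<close> are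
    unique; this is what makes \<open>wt\<close> linear below.\<close>
  have inj: "c = d" if "jscale c Y = jscale d Y" for c d
    using that Y(1) jscale_eq_0_iff[of "c - d" Y] by (simp add: jscale_diff_left)
  have "wt X0 = c"
    using inj wt[of X0] Y(3) by simp
  then have a0: "Re (wt X0) \<noteq> 0"
    using Y(4) by simp
  have "\<not> taming_symplectic br J \<Omega>" for \<Omega>
    using taming_weight_zero[OF lJ JJ _ y weight] a0 by blast
  moreover have "\<not> skt_metric br J g" if nil: "nilpotent brs UNIV" and sub: "J ` (UNIV \<times> {0}) \<subseteq> UNIV \<times> {0}" for g
  proof
    assume skt: "skt_metric br J g"
    define Js where "Js X = fst (J (X, 0))" for X
    have J1: "J (X, 0) = (Js X, 0)" for X
    proof -
      have "J (X, 0) \<in> UNIV \<times> {0}"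
        using sub by auto
      then show ?thesis
        by (cases "J (X, 0)") (simp add: Js_def)
    qed
    have br1: "br (X, 0) (X', 0) = (brs X X', 0)" for X X'
      by (simp add: assms(6) semidirect_bracket_def bilinear_lzero[OF blh])
    have cJs: "complex_structure brs Js"
      unfolding complex_structure_def
    proof (intro conjI allI)
      show "linear Js"
      proof (rule linearI)
        fix X X' r
        show "Js (X + X') = Js X + Js X'"
          using linear_add[OF lJ, of "(X, 0)" "(X', 0)"] by (simp add: J1)
        show "Js (r *\<^sub>R X) = r *\<^sub>R Js X"
          using linear_cmul[OF lJ, of r "(X, 0)"] by (simp add: J1)
      qed
      show "Js (Js X) = - X" for X
        using JJ[of "(X, 0)"] by (simp add: J1)
      show "brs (Js X) (Js X') - Js (brs (Js X) X') - Js (brs X (Js X')) - brs X X' = 0" for X X'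
        using integ[of "(X, 0)" "(X', 0)"] by (simp add: J1 br1 zero_prod_def)
    qed
    have "linear wt"
    proof (rule linearI; rule inj)
      fix X X' r
      have "\<phi> (X + X') Y = \<phi> X Y + \<phi> X' Y"
        by (simp add: linear_add[OF l\<phi>] blinfun.add_left)
      then show "jscale (wt (X + X')) Y = jscale (wt X + wt X') Y"
        by (simp add: wt jscale_add_left)
      have "\<phi> (r *\<^sub>R X) Y = r *\<^sub>R \<phi> X Y"
        by (simp add: linear_cmul[OF l\<phi>] blinfun.scaleR_left)
      then show "jscale (wt (r *\<^sub>R X)) Y = jscale (r *\<^sub>R wt X) Y"
        by (simp add: wt jscale_def scaleR_add_right)
    qed
    then have lwt: "linear (\<lambda>X. Re (wt X))"
      using linear_compose[of wt Re] bounded_linear.linear[OF bounded_linear_Re] by (simp add: comp_def)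
    \<comment> \<open>Scalars commute, so the commutator of \<open>\<phi> X\<close> and
      \<open>\<phi> X'\<close> kills \<open>Y\<close>.\<close>
    have wt0: "wt (brs X X') = 0" for X X'
    proof (rule inj)
      have "\<phi> (brs X X') Y = 0"
        using linear_commutes_jscale[OF linear_blinfun_apply comm]
        by (simp add: \<phi>br commutator_def blinfun.diff_left wt jscale_jscale mult.commute)
      then show "jscale (wt (brs X X')) Y = jscale 0 Y"
        by (simp add: wt)
    qed
    \<comment> \<open>The identity is taken at \<open>x = (X, 0)\<close>: there
      \<open>[x, J x]\<close> has weight zero by \<open>wt0\<close>, and \<open>J [x, J x]\<close>
      stays in the first factor and so has a weight.\<close>
    have id: "Re (wt (Js (brs X (Js X)))) = 2 * ((Re (wt X))\<^sup>2 + (Re (wt (Js X)))\<^sup>2)" for X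
    proof (rule skt_weight_identity[OF _ assms(7) skt y weight])
      show "lie_bracket br"
        unfolding assms(6) by (rule lie_bracket_semidirect[OF assms(1,3-5)])
      show "br (J (X, 0)) y = Re (wt (Js X)) *\<^sub>R y + Im (wt (Js X)) *\<^sub>R J y"
        "br (J (X, 0)) (J y) = Re (wt (Js X)) *\<^sub>R J y - Im (wt (Js X)) *\<^sub>R y"
        unfolding J1 by (rule weight)+
      show "br (br (X, 0) (J (X, 0))) y = 0" "br (br (X, 0) (J (X, 0))) (J y) = 0"
        by (simp_all add: J1 br1 weight wt0)
      show "br (J (br (X, 0) (J (X, 0)))) y = Re (wt (Js (brs X (Js X)))) *\<^sub>R y + Im (wt (Js (brs X (Js X)))) *\<^sub>R J y"
        "br (J (br (X, 0) (J (X, 0)))) (J y) = Re (wt (Js (brs X (Js X)))) *\<^sub>R J y - Im (wt (Js (brs X (Js X)))) *\<^sub>R y"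
        unfolding J1 br1 by (rule weight)+
    qed
    have "Re (wt (brs X X')) = 0" for X X'
      by (simp add: wt0)
    then have "Re (wt X0) = 0"
      by (rule nilpotent_functional_zero[OF assms(1) nil cJs lwt _ id])
    with a0 show False
      by simp
  qed
  ultimately show ?thesis
    by blast
qed

end
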